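(* Let $q$ be a prime power, let $\gamma$ be a primitive element of $\mathbb{F}_{q^2}$, and for any integer $a$ let $h_a(x)\in\mathbb{F}_q[x]$ be the minimal polynomial of $\gamma^{-a}$ over $\mathbb{F}_q$. Let $\mathcal{C}$ be a cyclic code of length $q^2-1$ over $\mathbb{F}_q$. Then the weight distribution of $\mathcal{C}$ is: weight $0$ with frequency $1$, weight $q(q-1)-1$ with frequency $(q-1)(q^2-1)$, weight $q(q-1)$ with frequency $q^2-1$, weight $q^2-1$ with frequency $q-1$ (and no other weights), if and only if $\mathcal{C}$ has dimension $3$ and there exist integers $e_1,e_2$ such that $h_{(q+1)e_1}(x)h_{e_2}(x)$ is the parity-check polynomial of $\mathcal{C}$, $\gcd(q-1,2e_1-e_2)=1$ and $\gcd(q+1,e_2)=1$. *)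

theory Defs
  imports "HOL-Computational_Algebra.Polynomial"
begin

text \<open>A field embedding of F_q (type 'a) into F_{q^2} (type 'b).\<close>
definition field_emb :: "('a::field \<Rightarrow> 'b::field) \<Rightarrow> bool" where
  "field_emb f \<longleftrightarrow> f 1 = 1 \<and> (\<forall>x y. f (x + y) = f x + f y) \<and> (\<forall>x y. f (x * y) = f x * f y)"

definition primitive_elem :: "'b::field \<Rightarrow> bool" where
  "primitive_elem g \<longleftrightarrow> (\<forall>x. x \<noteq> 0 \<longrightarrow> (\<exists>k::nat. x = g ^ k))"

definition minpoly :: "('a::field \<Rightarrow> 'b::field) \<Rightarrow> 'b \<Rightarrow> 'a poly" where
  "minpoly emb \<beta> = (THE p. lead_coeff p = 1 \<and> poly (map_poly emb p) \<beta> = 0 \<and>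
      (\<forall>r. r \<noteq> 0 \<longrightarrow> poly (map_poly emb r) \<beta> = 0 \<longrightarrow> degree p \<le> degree r))"

text \<open>Codewords of length n are polynomials c_0 + ... + c_{n-1} x^{n-1}.\<close>
definition words :: "nat \<Rightarrow> 'a::field poly set" where
  "words n = {c. c = 0 \<or> degree c < n}"

definition cyc_shift :: "nat \<Rightarrow> 'a::field poly \<Rightarrow> 'a poly" where
  "cyc_shift n c = (monom 1 1 * c) mod (monom 1 n - 1)"

definition cyclic_code :: "nat \<Rightarrow> 'a::field poly set \<Rightarrow> bool" where
  "cyclic_code n C \<longleftrightarrow> C \<subseteq> words n \<and> 0 \<in> C \<and>
     (\<forall>c\<in>C. \<forall>d\<in>C. c + d \<in> C) \<and> (\<forall>a. \<forall>c\<in>C. smult a c \<in> C) \<and>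
     (\<forall>c\<in>C. cyc_shift n c \<in> C)"

definition hweight :: "'a::zero poly \<Rightarrow> nat" where
  "hweight c = card {i. coeff c i \<noteq> 0}"

definition code_dim :: "'a::field poly set \<Rightarrow> nat" where
  "code_dim C = vector_space.dim smult C"

definition parity_check_poly :: "nat \<Rightarrow> 'a::field poly set \<Rightarrow> 'a poly \<Rightarrow> bool" where
  "parity_check_poly n C h \<longleftrightarrow> lead_coeff h = 1 \<and> h dvd (monom 1 n - 1) \<and>
     C = {c \<in> words n. ((monom 1 n - 1) div h) dvd c}"

end

theory Submission
  imports Defs "HOL-Library.FuncSet"
begin

text \<open>
  Let \<open>n = q\<^sup>2 - 1\<close>, which equals \<open>-1\<close> in the field. By Fourier inversion the entries of a codeword
  are combinations of powers of the inverse roots of the parity-check polynomial. For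
  \<open>h\<^bsub>(q+1)e\<^sub>1\<^esub> h\<^bsub>e\<^sub>2\<^esub>\<close> with \<open>q + 1\<close> not dividing \<open>e\<^sub>2\<close>, codewords thus correspond to pairs \<open>(A, B)\<close>, \<open>A\<close> in
  the small field and \<open>B\<close> in the large one, with entries
  \<open>x\<^bsup>(q+1)e\<^sub>1\<^esup> (A + Tr (B x\<^sup>m))\<close> at \<open>x = \<gamma>\<^sup>i\<close>, where \<open>m = e\<^sub>2 - (q+1)e\<^sub>1\<close>.

  The two gcd conditions together say that \<open>m\<close> is prime to \<open>n\<close>, so that \<open>x \<mapsto> x\<^sup>m\<close> permutes the
  nonzero elements and the number of zeros is read off the fibres of the trace, all of size \<open>q\<close>.

  Conversely, the distribution forces \<open>q\<^sup>3\<close> codewords, hence three roots, a set stable under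
  Frobenius. If all of them lay in the small field, every weight would be a multiple of \<open>q + 1\<close>, but
  \<open>q(q-1) - 1\<close> is not; so there is one rational root and one conjugate pair. If \<open>d\<close> divides
  \<open>n\<close> and \<open>k\<close>, the number of nonzero \<open>x\<close> for which \<open>x\<^sup>k\<close> has a given property is a multiple of \<open>d\<close>.
  Applied to the \<open>q\<close> zeros of a word of weight \<open>q(q-1) - 1\<close> this gives
  \<open>gcd(q-1, 2e\<^sub>1-e\<^sub>2) = 1\<close>; applied to the zeros \<open>(B x\<^bsup>e\<^sub>2\<^esup>)\<^bsup>q-1\<^esup> = -1\<close> of a word with \<open>A = 0\<close> and
  \<open>Tr B = 0\<close> it gives \<open>gcd(q+1, e\<^sub>2) = 1\<close>.
\<close>

section \<open>Counting in finite fields, residue classes and spans\<close>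

text \<open>Multiplication by \<open>x\<close> permutes the nonzero elements, so their product stays
  the same while gaining one factor \<open>x\<close> per element.\<close>

lemma finite_field_power_card_minus_one:
  fixes x :: "'c::{field,finite}"
  assumes "x \<noteq> 0"
  shows "x ^ (card (UNIV :: 'c set) - 1) = 1"
proof -
  let ?U = "UNIV - {0::'c}"
  have "bij_betw ((*) x) ?U ?U"
    by (rule bij_betwI[of _ _ _ "(*) (inverse x)"]) (use assms in auto)
  then have "(\<Prod>y\<in>?U. x * y) = \<Prod>?U"
    by (rule prod.reindex_bij_betw)
  then have "x ^ card ?U * \<Prod>?U = 1 * \<Prod>?U"
    by (simp add: prod.distrib)
  moreover have "\<Prod>?U \<noteq> 0"
    by simp
  ultimately show ?thesis
    by (simp add: card_Diff_singleton)
qed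

text \<open>Translation by 1 permutes the ring, so the sum of all elements is unchanged when 1 is
  added to each.\<close>

lemma finite_ring_of_nat_card_eq_0:
  "of_nat (card (UNIV :: 'c set)) = (0::'c::{ring_1,finite})"
proof -
  have "bij_betw (\<lambda>x::'c. x + 1) UNIV UNIV"
    by (rule bij_betwI[of _ _ _ "\<lambda>x. x - 1"]) auto
  then have "(\<Sum>x\<in>(UNIV::'c set). x + 1) = \<Sum>UNIV"
    by (rule sum.reindex_bij_betw)
  then show ?thesis
    by (simp add: sum.distrib)
qed

text \<open>Division with remainder cuts the range into \<open>d\<close> blocks of length
  \<open>k\<close>, and \<open>Q\<close> sees only the position inside a block.\<close>

lemma card_filter_mod:
  fixes d k :: nat
  assumes "k > 0"
  shows "card {i. i < d * k \<and> Q (i mod k)} = d * card {j. j < k \<and> Q j}"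
proof -
  let ?f = "\<lambda>(a, j). a * k + j"
  have "bij_betw ?f ({..<d} \<times> {j. j < k \<and> Q j}) {i. i < d * k \<and> Q (i mod k)}"
  proof (rule bij_betwI[of _ _ _ "\<lambda>i. (i div k, i mod k)"])
    have "a * k + j < d * k" if "a < d" "j < k" for a j
    proof -
      have "a * k + j < Suc a * k"
        using that by simp
      also have "\<dots> \<le> d * k"
        using that by (intro mult_le_mono1) simp
      finally show ?thesis .
    qed
    then show "?f \<in> {..<d} \<times> {j. j < k \<and> Q j} \<rightarrow> {i. i < d * k \<and> Q (i mod k)}"
      by auto
    show "(\<lambda>i. (i div k, i mod k)) \<in> {i. i < d * k \<and> Q (i mod k)} \<rightarrow> {..<d} \<times> {j. j < k \<and> Q j}"
      using assms by (auto simp: less_mult_imp_div_less)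
  qed (use assms in auto)
  from bij_betw_same_card[OF this] show ?thesis
    by (simp add: card_cartesian_product)
qed

lemma (in vector_space) card_span_independent:
  assumes "finite B" "independent B"
  shows "card (span B) = card (UNIV :: 'a set) ^ card B"
  using assms
proof (induction B rule: finite_induct)
  case empty
  then show ?case by simp
next
  case (insert b B)
  then have indep: "independent B" and b: "b \<notin> span B"
    by (auto simp: independent_insert)
  let ?f = "\<lambda>(k, v). scale k b + v"
  have "span (insert b B) = ?f ` (UNIV \<times> span B)"
  proof (intro equalityI subsetI)
    fix x assume "x \<in> span (insert b B)"
    then obtain k where "x - scale k b \<in> span B"
      by (auto simp: span_insert)
    then show "x \<in> ?f ` (UNIV \<times> span B)"
      by (intro image_eqI[of _ _ "(k, x - scale k b)"]) auto
  next
    fix x assume "x \<in> ?f ` (UNIV \<times> span B)"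
    then obtain k v where "x = scale k b + v" "v \<in> span B"
      by auto
    then show "x \<in> span (insert b B)"
      by (auto simp: span_insert intro!: exI[of _ k])
  qed
  moreover have "inj_on ?f (UNIV \<times> span B)"
  proof (rule inj_onI, clarsimp)
    fix k v k' v'
    assume v: "v \<in> span B" "v' \<in> span B" and eq: "scale k b + v = scale k' b + v'"
    then have "scale (k - k') b = v' - v"
      by (simp add: algebra_simps)
    then have "scale (k - k') b \<in> span B"
      using v by (simp add: span_diff)
    \<comment> \<open>A nonzero difference could be inverted, which would put \<open>b\<close> into
      \<open>span B\<close>.\<close>
    have "k = k'"
    proof (rule ccontr)
      assume "k \<noteq> k'"
      with span_scale[OF \<open>scale (k - k') b \<in> span B\<close>, of "inverse (k - k')"] b
      show False by simp
    qed
    with eq show "k = k' \<and> v = v'" by simp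
  qed
  ultimately have "card (span (insert b B)) = card (UNIV :: 'a set) * card (span B)"
    by (simp add: card_image card_cartesian_product)
  with insert indep show ?case
    by simp
qed

section \<open>Words as polynomials of bounded degree\<close>

lemma words_Suc: "words (Suc m) = (\<lambda>(a, p). pCons a p) ` (UNIV \<times> words m)"
proof (intro equalityI subsetI)
  fix c :: "'a poly" assume c: "c \<in> words (Suc m)"
  obtain a p where ap: "c = pCons a p"
    by (cases c)
  with c have "p \<in> words m"
    by (auto simp: words_def split: if_splits)
  then show "c \<in> (\<lambda>(a, p). pCons a p) ` (UNIV \<times> words m)"
    using ap by auto
qed (auto simp: words_def split: if_splits)

lemma card_words: "card (words m :: 'c::{field,finite} poly set) = card (UNIV :: 'c set) ^ m"
proof (induction m)
  case 0
  then show ?case by (simp add: words_def)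
next
  case (Suc m)
  have "inj_on (\<lambda>(a, p). pCons a p) (UNIV \<times> (words m :: 'c poly set))"
    by (auto intro: inj_onI)
  then show ?case
    using Suc by (simp add: words_Suc card_image card_cartesian_product)
qed

lemma finite_words: "finite (words m :: 'c::{field,finite} poly set)"
  by (rule card_ge_0_finite) (simp add: card_words card_gt_0_iff)

lemma degree_monom_minus_one:
  "n > 0 \<Longrightarrow> degree (monom 1 n - 1 :: 'c::comm_ring_1 poly) = n"
  using degree_diff_less[of "1 :: 'c poly" n] degree_add_eq_left[of "-1 :: 'c poly" "monom 1 n"]
  by (simp add: degree_monom_eq)

lemma lead_coeff_monom_minus_one:
  "n > 0 \<Longrightarrow> lead_coeff (monom 1 n - 1 :: 'c::comm_ring_1 poly) = 1"
  by (simp add: degree_monom_minus_one)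

lemma vector_space_smult: "vector_space (smult :: 'c::field \<Rightarrow> 'c poly \<Rightarrow> 'c poly)"
  by unfold_locales (simp_all add: smult_add_right smult_add_left)

section \<open>Cyclic codes, their size and their parity-check polynomials\<close>

text \<open>Lets the dimension be read off from the number of codewords, which a weight distribution
  determines.\<close>

lemma card_cyclic_code_eq_power_dim:
  fixes C :: "'c::{field,finite} poly set"
  assumes "cyclic_code n C"
  shows "card C = card (UNIV :: 'c set) ^ code_dim C"
proof -
  interpret vector_space "smult :: 'c \<Rightarrow> 'c poly \<Rightarrow> 'c poly"
    by (rule vector_space_smult)
  have sub: "subspace C"
    using assms by (simp add: cyclic_code_def subspace_def)
  have "C \<subseteq> words n"
    using assms by (simp add: cyclic_code_def)
  then have "finite C"
    by (rule finite_subset[OF _ finite_words])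
  obtain B where B: "B \<subseteq> C" "independent B" "C \<subseteq> span B" "card B = dim C"
    by (rule basis_exists)
  have "span B = C"
    using B sub span_minimal by blast
  with card_span_independent[of B] B \<open>finite C\<close> show ?thesis
    by (auto simp: code_dim_def dest: finite_subset)
qed

text \<open>Multiplication by any \<open>r\<close> is built up in Horner fashion from scalar
  multiples, sums and cyclic shifts.\<close>

lemma cyclic_code_mod_mult:
  assumes C: "cyclic_code n C" and p: "p mod (monom 1 n - 1) \<in> C"
  shows "(r * p) mod (monom 1 n - 1) \<in> C"
proof (induction r rule: pCons_induct)
  case 0
  then show ?case
    using C by (simp add: cyclic_code_def)
next
  case (pCons a r)
  let ?M = "monom 1 n - 1 :: 'a poly"
  have "pCons a r * p = smult a p + monom 1 1 * (r * p)"
    by (simp add: monom_altdef)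
  then have "(pCons a r * p) mod ?M = smult a (p mod ?M) + cyc_shift n ((r * p) mod ?M)"
    by (simp add: poly_mod_add_left mod_smult_left cyc_shift_def mod_mult_right_eq)
  then show ?case
    using C p pCons.IH by (simp add: cyclic_code_def)
qed

text \<open>The polynomials whose residue modulo \<open>M\<close> is a codeword form an ideal
  containing \<open>M\<close>. A nonzero element of least degree generates it, and the cofactor of
  its monic multiple in \<open>M\<close> is the required polynomial.\<close>

lemma cyclic_code_has_parity_check_poly:
  assumes n: "n > 0" and C: "cyclic_code n C"
  shows "\<exists>h. parity_check_poly n C h"
proof -
  define M where "M = (monom 1 n - 1 :: 'a poly)"
  have M: "degree M = n" "lead_coeff M = 1"
    unfolding M_def using degree_monom_minus_one[OF n] lead_coeff_monom_minus_one[OF n] .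
  then have "M \<noteq> 0"
    by auto
  define I where "I = {p. p mod M \<in> C}"
  have I_mult: "r * p \<in> I" if "p \<in> I" for r p
    using cyclic_code_mod_mult[OF C] that by (simp add: I_def M_def)
  have I_diff: "p - r \<in> I" if "p \<in> I" "r \<in> I" for p r
  proof -
    have "p mod M + (- 1 * r) mod M \<in> C"
      using that I_mult[of r "- 1"] C unfolding cyclic_code_def I_def by blast
    then have "(p + - 1 * r) mod M \<in> C"
      by (simp only: poly_mod_add_left)
    then show ?thesis by (simp add: I_def)
  qed
  have "M \<in> I"
    using C by (simp add: I_def cyclic_code_def)
  then obtain g0 where g0: "g0 \<in> I" "g0 \<noteq> 0" "\<And>r. r \<in> I \<Longrightarrow> r \<noteq> 0 \<Longrightarrow> degree g0 \<le> degree r"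
    using ex_has_least_nat[of "\<lambda>p. p \<in> I \<and> p \<noteq> 0" M degree] \<open>M \<noteq> 0\<close> by blast
  have I_iff: "p \<in> I \<longleftrightarrow> g0 dvd p" for p
  proof
    assume "p \<in> I"
    then have "p mod g0 \<in> I"
      using I_diff[OF _ I_mult[OF g0(1), of "p div g0"], of p]
      by (simp add: minus_div_mult_eq_mod)
    then have "p mod g0 = 0"
      using g0(3)[of "p mod g0"] degree_mod_less'[of g0 p] g0(2) by fastforce
    then show "g0 dvd p" by auto
  next
    assume "g0 dvd p"
    then show "p \<in> I"
      using I_mult[OF g0(1)] by (auto simp: mult.commute elim!: dvdE)
  qed
  define g where "g = smult (inverse (lead_coeff g0)) g0"
  have g: "g dvd p \<longleftrightarrow> p \<in> I" for p
    using g0(2) by (simp add: g_def I_iff smult_dvd_iff)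
  have g_monic: "lead_coeff g = 1"
    using g0(2) by (simp add: g_def)
  obtain h where h: "M = g * h"
    using g \<open>M \<in> I\<close> by (auto elim!: dvdE)
  have "lead_coeff h = 1"
    using M(2) g_monic by (simp add: h lead_coeff_mult)
  moreover have "h \<noteq> 0"
    using \<open>M \<noteq> 0\<close> h by auto
  then have "M div h = g"
    using h by simp
  moreover have "c \<in> C \<longleftrightarrow> c \<in> words n \<and> g dvd c" for c
  proof -
    have "c \<in> words n" if "c \<in> C"
      using C that by (auto simp: cyclic_code_def)
    moreover have "c mod M = c" if "c \<in> words n"
      using that M(1) n by (auto simp: words_def mod_poly_less)
    ultimately show ?thesis
      by (auto simp: g I_def)
  qed
  ultimately show ?thesis
    unfolding parity_check_poly_def M_def[symmetric] using h by (intro exI[of _ h]) auto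
qed

text \<open>Names the generator polynomial \<open>g\<close>, so that later arguments need no
  polynomial division.\<close>

lemma parity_check_poly_factor:
  assumes "parity_check_poly n C h" "n > 0"
  obtains g where "monom 1 n - 1 = g * h" "g \<noteq> 0" "h \<noteq> 0" "degree g + degree h = n"
    "C = {c \<in> words n. g dvd c}"
proof -
  let ?M = "monom 1 n - 1 :: 'a poly"
  have M: "?M \<noteq> 0" "degree ?M = n"
    using degree_monom_minus_one[OF assms(2), where 'c = 'a] assms(2) by auto
  have eq: "?M = (?M div h) * h"
    using assms(1) by (simp add: parity_check_poly_def)
  with M have "?M div h \<noteq> 0" "h \<noteq> 0"
    by force+
  then have "degree (?M div h) + degree h = n"
    using degree_mult_eq[of "?M div h" h] M(2) eq by simp
  then show ?thesis
    using that[OF eq] \<open>?M div h \<noteq> 0\<close> \<open>h \<noteq> 0\<close> assms(1) by (simp add: parity_check_poly_def)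
qed

text \<open>Multiplication by the generator maps the words of length \<open>degree h\<close>
  bijectively onto the code.\<close>

lemma card_code_eq_power_degree:
  fixes C :: "'c::{field,finite} poly set"
  assumes "parity_check_poly n C h" "n > 0"
  shows "card C = card (UNIV :: 'c set) ^ degree h"
proof -
  obtain g where g: "g \<noteq> 0" "h \<noteq> 0" "degree g + degree h = n" "C = {c \<in> words n. g dvd c}"
    using parity_check_poly_factor[OF assms] by metis
  have "C = (*) g ` words (degree h)"
  proof (intro equalityI subsetI)
    fix c assume "c \<in> C"
    with g obtain r where r: "c = g * r" "c \<in> words n"
      by (auto elim!: dvdE)
    then have "r \<in> words (degree h)"
      using g by (cases "r = 0") (auto simp: words_def degree_mult_eq)
    with r show "c \<in> (*) g ` words (degree h)" by auto
  next
    fix c assume "c \<in> (*) g ` words (degree h)"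
    then obtain r where "c = g * r" "r \<in> words (degree h)" by auto
    then show "c \<in> C"
      using g by (cases "r = 0") (auto simp: words_def degree_mult_eq)
  qed
  moreover have "inj_on ((*) g) (words (degree h))"
    using g(1) by (auto intro: inj_onI)
  ultimately show ?thesis
    by (simp add: card_image card_words)
qed

section \<open>The quadratic extension and its primitive element\<close>

locale quadratic_extension =
  fixes emb :: "'a::{field,finite} \<Rightarrow> 'b::{field,finite}" and \<gamma> :: 'b and q n :: nat
  assumes q_eq: "q = card (UNIV :: 'a set)"
    and card_ext: "card (UNIV :: 'b set) = q ^ 2"
    and emb: "field_emb emb"
    and primitive: "primitive_elem \<gamma>"
    and n_eq: "n = q ^ 2 - 1"
begin

lemma q_ge_2: "q \<ge> 2"
proof -
  have "card {0, 1 :: 'a} \<le> q"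
    unfolding q_eq by (rule card_mono) auto
  then show ?thesis by simp
qed

lemma n_factor: "n = (q - 1) * (q + 1)"
  unfolding n_eq by (simp add: power2_eq_square algebra_simps)

lemma int_n: "int n = (int q - 1) * (int q + 1)"
  using q_ge_2 by (simp add: n_factor of_nat_diff algebra_simps)

lemma n_pos: "n > 0"
  using q_ge_2 by (simp add: n_factor)

lemma card_nonzero: "card {x::'b. x \<noteq> 0} = n"
proof -
  have "{x::'b. x \<noteq> 0} = UNIV - {0}" by auto
  then show ?thesis
    by (simp add: card_Diff_singleton card_ext n_eq)
qed

lemma power_n: "x \<noteq> 0 \<Longrightarrow> x ^ n = 1" for x :: 'b
  using finite_field_power_card_minus_one[of x] by (simp add: card_ext n_eq)

lemma power_q_square: "x ^ (q * q) = x" for x :: 'b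
proof (cases "x = 0")
  case False
  have "q * q = Suc n"
    using q_ge_2 by (simp add: n_eq power2_eq_square)
  then show ?thesis
    using power_n[OF False] by simp
qed (use q_ge_2 in simp)

text \<open>The field has \<open>n + 1\<close> elements, and this number is 0 in it. Division by the
  group order is therefore a mere change of sign.\<close>

lemma of_nat_n: "of_nat n = (- 1 :: 'b)"
proof -
  have "q ^ 2 = Suc n"
    using q_ge_2 by (simp add: n_eq)
  then have "of_nat (Suc n) = (0::'b)"
    using finite_ring_of_nat_card_eq_0[where 'c = 'b] card_ext by simp
  then show ?thesis
    by (simp add: eq_neg_iff_add_eq_0 add.commute)
qed

text \<open>The powers of 0 are only 0 and 1, while the field has at least four elements.\<close>

lemma gamma_nonzero: "\<gamma> \<noteq> 0"
proof
  assume "\<gamma> = 0"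
  have "x \<in> {0, 1}" for x :: 'b
  proof (cases "x = 0")
    case False
    then obtain k where "x = \<gamma> ^ k"
      using primitive by (auto simp: primitive_elem_def)
    then show ?thesis
      using \<open>\<gamma> = 0\<close> by (cases k) auto
  qed simp
  then have "card (UNIV :: 'b set) \<le> card {0, 1 :: 'b}"
    by (intro card_mono) auto
  moreover have "2 ^ 2 \<le> q ^ 2"
    using q_ge_2 by (intro power_mono) auto
  ultimately show False
    using card_ext by simp
qed

text \<open>Primitivity and reduction of exponents modulo \<open>n\<close> give surjectivity;
  injectivity follows since both sets have \<open>n\<close> elements.\<close>

lemma bij_betw_power_gamma: "bij_betw (\<lambda>i. \<gamma> ^ i) {..<n} {x. x \<noteq> 0}"
proof -
  have "(\<lambda>i. \<gamma> ^ i) ` {..<n} = {x. x \<noteq> 0}"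
  proof (intro equalityI subsetI)
    fix x assume "x \<in> {x::'b. x \<noteq> 0}"
    then obtain k where "x = \<gamma> ^ k"
      using primitive by (auto simp: primitive_elem_def)
    also have "\<dots> = \<gamma> ^ (n * (k div n) + k mod n)"
      by simp
    also have "\<dots> = \<gamma> ^ (k mod n)"
      using power_n[OF gamma_nonzero] by (simp only: power_add power_mult) simp
    finally show "x \<in> (\<lambda>i. \<gamma> ^ i) ` {..<n}"
      using n_pos by auto
  qed (use gamma_nonzero in auto)
  then show ?thesis
    using eq_card_imp_inj_on[of "{..<n}" "\<lambda>i. \<gamma> ^ i"] card_nonzero
    by (simp add: bij_betw_def)
qed

lemma nonzero_eq_power_gamma:
  assumes "x \<noteq> 0"
  obtains i where "i < n" "x = \<gamma> ^ i"
  using bij_betw_power_gamma assms by (auto simp: bij_betw_def)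

lemma power_int_mod_n:
  assumes "x \<noteq> 0" "int n dvd k - l"
  shows "x powi k = (x::'b) powi l"
proof -
  obtain j where "k = l + int n * j"
    using assms(2) by (metis dvdE diff_add_cancel add.commute)
  then show ?thesis
    using assms(1) power_n[OF assms(1)] by (simp add: power_int_add power_int_mult)
qed

lemma gamma_powi_eq_1_iff: "\<gamma> powi k = 1 \<longleftrightarrow> int n dvd k"
proof -
  define i where "i = nat (k mod int n)"
  have i: "i < n" "int i = k mod int n"
    using n_pos by (auto simp: i_def nat_less_iff)
  have "int n dvd k - int i"
    unfolding i(2) by (simp add: minus_mod_eq_mult_div)
  then have "\<gamma> powi k = \<gamma> ^ i"
    using power_int_mod_n[OF gamma_nonzero, of k "int i"] by simp
  moreover have "\<gamma> ^ i = 1 \<longleftrightarrow> i = 0"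
    using inj_onD[OF bij_betw_imp_inj_on[OF bij_betw_power_gamma], of i 0] i(1) n_pos by auto
  ultimately show ?thesis
    using i(2) by (auto simp: dvd_eq_mod_eq_0)
qed

text \<open>For \<open>x = \<gamma> ^ i\<close> the value \<open>x powi m\<close> depends only on
  \<open>i\<close> modulo \<open>n div d\<close>, so the exponents that count fill \<open>d\<close>
  equal periods.\<close>

lemma dvd_card_power_int:
  assumes "d dvd n" "int d dvd m"
  shows "d dvd card {x::'b. x \<noteq> 0 \<and> P (x powi m)}"
proof -
  obtain k where k: "n = d * k"
    using assms(1) by auto
  obtain l where l: "m = int d * l"
    using assms(2) by auto
  have kpos: "k > 0"
    using k n_pos by auto
  have per: "(\<gamma> ^ i) powi m = (\<gamma> ^ (i mod k)) powi m" for i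
  proof -
    have "int i - int (i mod k) = int k * int (i div k)"
      by (simp add: minus_mod_eq_mult_div zmod_int zdiv_int)
    then have "int i * m - int (i mod k) * m = int n * (int (i div k) * l)"
      unfolding k l left_diff_distrib[symmetric] by simp
    then show ?thesis
      using power_int_mod_n[OF gamma_nonzero, of "int i * m" "int (i mod k) * m"]
      by (simp add: power_int_mult)
  qed
  have "bij_betw (\<lambda>i. \<gamma> ^ i) {i. i < d * k \<and> P ((\<gamma> ^ (i mod k)) powi m)} {x. x \<noteq> 0 \<and> P (x powi m)}"
  proof (rule bij_betw_subset[OF bij_betw_power_gamma])
    show "{i. i < d * k \<and> P ((\<gamma> ^ (i mod k)) powi m)} \<subseteq> {..<n}"
      by (auto simp: k)
    show "(\<lambda>i. \<gamma> ^ i) ` {i. i < d * k \<and> P ((\<gamma> ^ (i mod k)) powi m)} = {x. x \<noteq> 0 \<and> P (x powi m)}"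
    proof (intro equalityI subsetI)
      fix x assume x: "x \<in> {x. x \<noteq> 0 \<and> P (x powi m)}"
      then obtain i where "i < n" "x = \<gamma> ^ i"
        using nonzero_eq_power_gamma by blast
      with x per[of i] show "x \<in> (\<lambda>i. \<gamma> ^ i) ` {i. i < d * k \<and> P ((\<gamma> ^ (i mod k)) powi m)}"
        by (auto simp: k)
    qed (use per gamma_nonzero in auto)
  qed
  then have "card {x::'b. x \<noteq> 0 \<and> P (x powi m)} = card {i. i < d * k \<and> P ((\<gamma> ^ (i mod k)) powi m)}"
    by (simp add: bij_betw_same_card)
  also have "\<dots> = d * card {j. j < k \<and> P ((\<gamma> ^ j) powi m)}"
    by (rule card_filter_mod[OF kpos])
  finally show ?thesis by simp
qed

text \<open>A Bezout inverse \<open>u\<close> of \<open>m\<close> modulo \<open>n\<close> gives the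
  inverse map.\<close>

lemma bij_betw_power_int:
  assumes "coprime m (int n)"
  shows "bij_betw (\<lambda>x::'b. x powi m) {x. x \<noteq> 0} {x. x \<noteq> 0}"
proof -
  obtain u v where uv: "u * m + v * int n = 1"
    using bezout_int[of m "int n"] assms by auto
  have inv: "x powi (u * m) = x" if "x \<noteq> 0" for x :: 'b
  proof -
    have "u * m - 1 = int n * - v"
      using uv by (simp add: algebra_simps)
    then show ?thesis
      using power_int_mod_n[OF that, of "u * m" 1] by simp
  qed
  show ?thesis
    by (rule bij_betwI[of _ _ _ "\<lambda>x. x powi u"])
      (use inv in \<open>auto simp: mult.commute simp flip: power_int_mult\<close>)
qed

section \<open>The embedded subfield, Frobenius and the trace\<close>

lemma emb_1 [simp]: "emb 1 = 1" and emb_add: "emb (x + y) = emb x + emb y"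
  and emb_mult: "emb (x * y) = emb x * emb y"
  using emb by (auto simp: field_emb_def)

lemma emb_0 [simp]: "emb 0 = 0"
  using emb_add[of 0 0] by (simp only: add_0_left add_cancel_right_right)

lemma emb_minus: "emb (- x) = - emb x"
  using emb_add[of x "- x"] by (simp add: eq_neg_iff_add_eq_0 add.commute)

lemma emb_power: "emb (x ^ k) = emb x ^ k"
  by (induction k) (simp_all add: emb_mult)

lemma emb_sum: "emb (\<Sum>i\<in>A. f i) = (\<Sum>i\<in>A. emb (f i))"
  by (induction A rule: infinite_finite_induct) (simp_all add: emb_add)

lemma emb_eq_0_iff [simp]: "emb x = 0 \<longleftrightarrow> x = 0"
proof
  assume "emb x = 0"
  then have "emb (x * inverse x) = 0"
    by (simp add: emb_mult)
  then show "x = 0"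
    by (cases "x = 0") auto
qed simp

lemma inj_emb: "inj emb"
proof (rule injI)
  fix x y assume "emb x = emb y"
  then have "emb (x + - y) = 0"
    by (simp only: emb_add emb_minus) simp
  then show "x = y" by simp
qed

lemma card_range_emb: "card (range emb) = q"
  by (simp add: card_image inj_emb q_eq)

text \<open>The \<open>q\<close> embedded elements are roots of X^q - X, which has at most
  \<open>q\<close> roots. Membership in the subfield thus becomes invariance under
  Frobenius.\<close>

lemma range_emb: "range emb = {y. y ^ q = y}"
proof (rule card_subset_eq)
  have "(x::'a) ^ q = x" for x
  proof (cases "x = 0")
    case False
    have "q = Suc (card (UNIV :: 'a set) - 1)"
      using q_ge_2 q_eq by simp
    then show ?thesis
      using finite_field_power_card_minus_one[OF False] by (metis power_Suc mult.right_neutral)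
  qed (use q_ge_2 in simp)
  then show sub: "range emb \<subseteq> {y. y ^ q = y}"
    by (auto simp: emb_power[symmetric])
  define P where "P = (monom 1 q - monom 1 1 :: 'b poly)"
  have "degree P = q"
    unfolding P_def using q_ge_2 degree_add_eq_left[of "- monom 1 1 :: 'b poly" "monom 1 q"]
    by (simp add: degree_monom_eq)
  then have "card {y. poly P y = 0} \<le> q"
    using card_poly_roots_bound[of P] q_ge_2 by force
  then have "card {y::'b. y ^ q = y} \<le> q"
    by (simp add: P_def poly_monom)
  with card_mono[OF _ sub] show "card (range emb) = card {y::'b. y ^ q = y}"
    by (simp add: card_range_emb)
qed simp

lemma range_emb_add_closed: "x \<in> range emb \<Longrightarrow> y \<in> range emb \<Longrightarrow> x + y \<in> range emb"
  by (auto simp flip: emb_add)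

text \<open>\<open>(X + 1)\<^sup>q - X\<^sup>q - 1\<close> has degree below \<open>q\<close> and the \<open>q\<close> elements of the small field as
  roots, so it vanishes; no appeal to the characteristic is needed.\<close>
lemma frobenius_add: "(x + y) ^ q = x ^ q + (y::'b) ^ q"
proof -
  have "[:1, 1:] ^ q = (monom 1 q + 1 :: 'b poly)"
  proof (rule poly_eqI_degree_lead_coeff[of _ q _ "range emb"])
    show "coeff ([:1, 1:] ^ q) q = coeff (monom 1 q + 1 :: 'b poly) q"
      using q_ge_2 coeff_linear_power[of "1::'b" q] by simp
    show "degree (monom 1 q + 1 :: 'b poly) \<le> q"
      by (intro degree_add_le) (simp_all add: degree_monom_le)
    show "poly ([:1, 1:] ^ q) z = poly (monom 1 q + 1) z" if "z \<in> range emb" for z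
    proof -
      have "1 + z \<in> range emb"
        using that range_emb_add_closed[of 1 z] rangeI[of emb 1] by simp
      then show ?thesis
        using that by (simp add: range_emb poly_monom)
    qed
  qed (simp_all add: card_range_emb degree_linear_power)
  then have "poly ([:1, 1:] ^ q) z = poly (monom 1 q + 1) z" for z :: 'b
    by simp
  then have one: "(1 + z) ^ q = z ^ q + 1" for z :: 'b
    by (simp add: poly_monom)
  show ?thesis
  proof (cases "y = 0")
    case False
    then have "x + y = y * (1 + x / y)"
      by (simp add: field_simps)
    then have "(x + y) ^ q = y ^ q * (1 + x / y) ^ q"
      by (simp only: power_mult_distrib)
    then show ?thesis
      using False by (simp add: one power_divide distrib_left)
  qed (use q_ge_2 in simp)
qed

lemma frobenius_sum: "(\<Sum>i\<in>A. f i) ^ q = (\<Sum>i\<in>A. (f i :: 'b) ^ q)"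
  by (induction A rule: infinite_finite_induct) (use q_ge_2 in \<open>simp_all add: frobenius_add\<close>)

text \<open>Additivity of Frobenius yields this without a case split on the parity of
  \<open>q\<close>.\<close>

lemma frobenius_minus: "(- x) ^ q = - (x ^ q)" for x :: 'b
  using frobenius_add[of x "- x"] q_ge_2 by (simp add: eq_neg_iff_add_eq_0 add.commute zero_power)

text \<open>The trace to the small field, kept as an element of the large one so that
  \<open>emb\<close> need not be inverted.\<close>

definition tr :: "'b \<Rightarrow> 'b" where
  "tr x = x + x ^ q"

lemma tr_in_range: "tr x \<in> range emb"
  by (simp add: range_emb tr_def frobenius_add power_mult[symmetric] power_q_square add.commute)

text \<open>Each fibre is the root set of a polynomial of degree \<open>q\<close>, so it has at most
  \<open>q\<close> elements. As \<open>q\<close> fibres cover all \<open>q * q\<close> elements,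
  none can be smaller.\<close>

lemma card_tr_fibre:
  assumes "t \<in> range emb"
  shows "card {y. tr y = t} = q"
proof -
  have le: "card {y. tr y = s} \<le> q" for s
  proof -
    define P where "P = (monom 1 q + [:- s, 1:] :: 'b poly)"
    have "degree P = q"
      unfolding P_def using q_ge_2 degree_add_eq_left[of "[:- s, 1:]" "monom 1 q"]
      by (simp add: degree_monom_eq)
    then have "card {y. poly P y = 0} \<le> q"
      using card_poly_roots_bound[of P] q_ge_2 by force
    moreover have "{y. poly P y = 0} = {y. tr y = s}"
      by (auto simp: P_def poly_monom tr_def algebra_simps)
    ultimately show ?thesis by simp
  qed
  have "q * q = card (UNIV :: 'b set)"
    by (simp add: card_ext power2_eq_square)
  also have "(UNIV :: 'b set) = (\<Union>s\<in>range emb. {y. tr y = s})"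
    using tr_in_range by auto
  also have "card \<dots> = (\<Sum>s\<in>range emb. card {y. tr y = s})"
    by (intro card_UN_disjoint) auto
  also have "\<dots> = card {y. tr y = t} + (\<Sum>s\<in>range emb - {t}. card {y. tr y = s})"
    using assms by (intro sum.remove) auto
  also have "(\<Sum>s\<in>range emb - {t}. card {y. tr y = s}) \<le> (q - 1) * q"
    using sum_bounded_above[of "range emb - {t}" "\<lambda>s. card {y. tr y = s}" q] le assms
    by (simp add: card_Diff_singleton card_range_emb)
  finally have "q * q \<le> card {y. tr y = t} + (q - 1) * q"
    by simp
  moreover have "q * q = q + (q - 1) * q"
    using q_ge_2 by (simp add: algebra_simps)
  ultimately have "q \<le> card {y. tr y = t}"
    by linarith
  with le[of t] show ?thesis by simp
qed

section \<open>Evaluation in the large field and Fourier inversion\<close>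

abbreviation ev :: "'a poly \<Rightarrow> 'b \<Rightarrow> 'b" where
  "ev p x \<equiv> poly (map_poly emb p) x"

lemma coeff_map_emb: "coeff (map_poly emb p) i = emb (coeff p i)"
  by (simp add: coeff_map_poly)

lemma degree_map_emb: "degree (map_poly emb p) = degree p"
  by (simp add: degree_map_poly)

lemma map_emb_eq_0_iff: "map_poly emb p = 0 \<longleftrightarrow> p = 0"
  by (auto simp: poly_eq_iff coeff_map_emb)

lemma map_emb_inject: "map_poly emb p = map_poly emb r \<longleftrightarrow> p = r"
  using inj_emb by (auto simp: poly_eq_iff coeff_map_emb inj_eq)

lemma map_emb_mult: "map_poly emb (p * r) = map_poly emb p * map_poly emb r"
  by (rule poly_eqI) (simp add: coeff_map_emb coeff_mult emb_sum emb_mult)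

lemma map_emb_diff: "map_poly emb (p - r) = map_poly emb p - map_poly emb r"
  using emb_add[of _ "- _"] by (intro poly_eqI) (simp add: coeff_map_emb emb_minus)

lemma map_emb_monom_minus_one: "map_poly emb (monom 1 k - 1) = monom 1 k - 1"
  by (rule poly_eqI) (auto simp: map_emb_diff coeff_map_emb)

text \<open>Frobenius is a ring homomorphism that fixes the coefficients. Hence roots come in
  conjugates, and a value at one point determines the value at its conjugate.\<close>

lemma ev_frobenius: "ev p (x ^ q) = ev p x ^ q"
proof -
  have "emb y ^ q = emb y" for y
    using range_emb by blast
  then show ?thesis
    by (simp add: poly_altdef frobenius_sum power_mult_distrib degree_map_emb coeff_map_emb
        mult.commute flip: power_mult)
qed

lemma ev_in_range: "x \<in> range emb \<Longrightarrow> ev p x \<in> range emb"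
  using ev_frobenius[of p x] by (simp add: range_emb)

text \<open>Orthogonality of characters: replacing \<open>x\<close> by \<open>\<gamma> * x\<close>
  multiplies the sum by \<open>\<gamma> powi k\<close>, which is 1 only if \<open>n\<close> divides
  \<open>k\<close>; in that case all \<open>n\<close> terms are 1.\<close>

lemma sum_power_int_nonzero:
  "(\<Sum>x | x \<noteq> 0. (x::'b) powi k) = (if int n dvd k then - 1 else 0)"
proof (cases "int n dvd k")
  case True
  then have "(\<Sum>x | x \<noteq> 0. (x::'b) powi k) = (\<Sum>x | x \<noteq> (0::'b). 1)"
    using power_int_mod_n[of _ k 0] by (intro sum.cong) auto
  then show ?thesis
    using True by (simp add: card_nonzero of_nat_n)
next
  case False
  let ?S = "\<Sum>x | x \<noteq> 0. (x::'b) powi k"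
  have "bij_betw ((*) \<gamma>) {x. x \<noteq> 0} {x. x \<noteq> 0}"
    by (rule bij_betwI[of _ _ _ "(*) (inverse \<gamma>)"]) (use gamma_nonzero in auto)
  then have "(\<Sum>x | x \<noteq> 0. (\<gamma> * x) powi k) = ?S"
    by (rule sum.reindex_bij_betw)
  then have "(\<gamma> powi k - 1) * ?S = 0"
    by (simp add: power_int_mult_distrib left_diff_distrib flip: sum_distrib_left)
  then show ?thesis
    using False gamma_powi_eq_1_iff by auto
qed

text \<open>Fourier inversion on the multiplicative group, whose order \<open>n\<close> is \<open>-1\<close> in the field.\<close>
lemma coeff_eq_sum_ev:
  assumes "c \<in> words n" "i < n"
  shows "emb (coeff c i) = - (\<Sum>x | x \<noteq> 0. ev c x * x powi (- int i))"
proof -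
  have ev: "ev c x = (\<Sum>j<n. emb (coeff c j) * x ^ j)" for x
  proof -
    have "degree c < n"
      using assms n_pos by (auto simp: words_def)
    then have "(\<Sum>j\<le>degree c. emb (coeff c j) * x ^ j) = (\<Sum>j<n. emb (coeff c j) * x ^ j)"
      by (intro sum.mono_neutral_left) (auto simp: coeff_eq_0)
    then show ?thesis
      by (simp add: poly_altdef degree_map_emb coeff_map_emb)
  qed
  have "(\<Sum>x | x \<noteq> 0. ev c x * x powi (- int i))
      = (\<Sum>x | x \<noteq> 0. \<Sum>j<n. emb (coeff c j) * x powi (int j - int i))"
    unfolding ev sum_distrib_right
    by (intro sum.cong refl) (simp add: power_int_diff power_int_minus divide_inverse)
  also have "\<dots> = (\<Sum>j<n. emb (coeff c j) * (\<Sum>x | x \<noteq> 0. x powi (int j - int i)))"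
    by (subst sum.swap) (simp add: sum_distrib_left)
  also have "\<dots> = (\<Sum>j<n. if j = i then - emb (coeff c i) else 0)"
  proof (intro sum.cong refl)
    fix j assume "j \<in> {..<n}"
    then have "int n dvd int j - int i \<longleftrightarrow> j = i"
      using assms(2) zdvd_imp_le[of "int n" "\<bar>int j - int i\<bar>"] by (cases "j = i") auto
    then show "emb (coeff c j) * (\<Sum>x | x \<noteq> 0. x powi (int j - int i))
        = (if j = i then - emb (coeff c i) else 0)"
      by (simp add: sum_power_int_nonzero)
  qed
  finally show ?thesis
    using assms(2) by simp
qed

text \<open>The product \<open>g * h\<close> = X^n - 1 vanishes at all \<open>n\<close> nonzero
  elements. Since the degrees of \<open>g\<close> and \<open>h\<close> add up to \<open>n\<close>,
  each has as many roots as its degree allows, and a nonzero non-root of \<open>h\<close> is a root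
  of \<open>g\<close>, hence of every codeword.\<close>

lemma
  assumes "parity_check_poly n C h"
  shows parity_check_root_nonzero: "ev h x = 0 \<Longrightarrow> x \<noteq> 0"
    and card_parity_check_roots: "card {x. ev h x = 0} = degree h"
    and codeword_ev_eq_0: "c \<in> C \<Longrightarrow> x \<noteq> 0 \<Longrightarrow> ev h x \<noteq> 0 \<Longrightarrow> ev c x = 0"
proof -
  obtain g where g: "monom 1 n - 1 = g * h" "g \<noteq> 0" "h \<noteq> 0" "degree g + degree h = n"
      "C = {c \<in> words n. g dvd c}"
    using parity_check_poly_factor[OF assms n_pos] by metis
  have ev_gh: "ev g x * ev h x = x ^ n - 1" for x
    using arg_cong[OF g(1), of "\<lambda>p. ev p x"]
    by (simp add: map_emb_monom_minus_one map_emb_mult poly_monom)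
  show nz: "x \<noteq> 0" if "ev h x = 0" for x
    using ev_gh[of x] that n_pos by (auto simp: zero_power)
  have nz': "x \<noteq> 0" if "ev g x = 0" for x
    using ev_gh[of x] that n_pos by (auto simp: zero_power)
  have "card {x. ev h x = 0} \<le> degree h" "card {x. ev g x = 0} \<le> degree g"
    using card_poly_roots_bound[of "map_poly emb h"] card_poly_roots_bound[of "map_poly emb g"] g
    by (simp_all add: degree_map_emb map_emb_eq_0_iff)
  moreover have "{x::'b. x \<noteq> 0} = {x. ev g x = 0} \<union> {x. ev h x = 0}"
  proof (intro set_eqI iffI)
    fix x assume "x \<in> {x::'b. x \<noteq> 0}"
    then show "x \<in> {x. ev g x = 0} \<union> {x. ev h x = 0}"
      using ev_gh[of x] power_n[of x] by simp
  next
    fix x assume "x \<in> {x. ev g x = 0} \<union> {x. ev h x = 0}"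
    then show "x \<in> {x. x \<noteq> 0}"
      using nz[of x] nz'[of x] by blast
  qed
  then have "n \<le> card {x. ev g x = 0} + card {x. ev h x = 0}"
    using card_nonzero card_Un_le[of "{x. ev g x = 0}" "{x. ev h x = 0}"] by simp
  ultimately show "card {x. ev h x = 0} = degree h"
    using g(4) by linarith
  show "ev c x = 0" if "c \<in> C" "x \<noteq> 0" "ev h x \<noteq> 0"
  proof -
    have "ev g x = 0"
      using ev_gh[of x] that power_n[of x] by simp
    moreover have "g dvd c"
      using \<open>c \<in> C\<close> g(5) by blast
    then obtain r where "c = g * r"
      by (rule dvdE)
    ultimately show ?thesis
      by (simp add: map_emb_mult)
  qed
qed

lemma codeword_coeff:
  assumes pc: "parity_check_poly n C h" and c: "c \<in> C" and i: "i < n"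
  shows "emb (coeff c i) = - (\<Sum>x | ev h x = 0. ev c x * x powi (- int i))"
proof -
  have "c \<in> words n"
    using pc c by (auto simp: parity_check_poly_def)
  then have "emb (coeff c i) = - (\<Sum>x | x \<noteq> 0. ev c x * x powi (- int i))"
    using i by (rule coeff_eq_sum_ev)
  also have "(\<Sum>x | x \<noteq> 0. ev c x * x powi (- int i)) = (\<Sum>x | ev h x = 0. ev c x * x powi (- int i))"
    using parity_check_root_nonzero[OF pc] codeword_ev_eq_0[OF pc c]
    by (intro sum.mono_neutral_right) auto
  finally show ?thesis .
qed

text \<open>Moves the count from positions to nonzero field elements, where permutations and trace
  fibres are available.\<close>

lemma hweight_eq_card:
  assumes c: "c \<in> words n" and f: "\<And>i. i < n \<Longrightarrow> coeff c i \<noteq> 0 \<longleftrightarrow> P (\<gamma> ^ i)"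
  shows "hweight c = card {x. x \<noteq> 0 \<and> P x}"
proof -
  have lt: "i < n" if "coeff c i \<noteq> 0" for i
    using c that le_degree[OF that] by (auto simp: words_def)
  have "bij_betw (\<lambda>i. \<gamma> ^ i) {i. coeff c i \<noteq> 0} {x. x \<noteq> 0 \<and> P x}"
  proof (rule bij_betw_subset[OF bij_betw_power_gamma])
    show "(\<lambda>i. \<gamma> ^ i) ` {i. coeff c i \<noteq> 0} = {x. x \<noteq> 0 \<and> P x}"
    proof (intro equalityI subsetI)
      fix x assume x: "x \<in> {x. x \<noteq> 0 \<and> P x}"
      then obtain i where "i < n" "x = \<gamma> ^ i"
        using nonzero_eq_power_gamma by blast
      with x show "x \<in> (\<lambda>i. \<gamma> ^ i) ` {i. coeff c i \<noteq> 0}"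
        using f[of i] by auto
    qed (use f lt gamma_nonzero in auto)
  qed (use lt in auto)
  then show ?thesis
    unfolding hweight_def by (rule bij_betw_same_card)
qed

section \<open>Minimal polynomials over the small field\<close>

text \<open>Two monic candidates of equal degree have a difference of smaller degree with the same
  root, so it must vanish.\<close>

lemma minpoly_eqI:
  assumes "lead_coeff p = 1" "ev p x = 0"
    and min: "\<And>r. r \<noteq> 0 \<Longrightarrow> ev r x = 0 \<Longrightarrow> degree p \<le> degree r"
  shows "minpoly emb x = p"
  unfolding minpoly_def
proof (rule the_equality)
  fix p' assume p': "lead_coeff p' = 1 \<and> ev p' x = 0 \<and>
    (\<forall>r. r \<noteq> 0 \<longrightarrow> ev r x = 0 \<longrightarrow> degree p' \<le> degree r)"
  have "p \<noteq> 0" "p' \<noteq> 0"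
    using assms(1) p' by auto
  then have deg: "degree p' = degree p"
    using p' assms(2) min[of p'] by (simp add: eq_iff)
  show "p' = p"
  proof (rule ccontr)
    assume "p' \<noteq> p"
    then have nz: "p' - p \<noteq> 0" by simp
    moreover have "ev (p' - p) x = 0"
      using p' assms(2) by (simp add: map_emb_diff)
    ultimately have "degree p \<le> degree (p' - p)"
      by (rule min)
    moreover have "degree (p' - p) \<le> degree p"
      using deg by (intro degree_diff_le) auto
    ultimately have "degree (p' - p) = degree p" by simp
    moreover have "coeff (p' - p) (degree p) = 0"
      using deg p' assms(1) by simp
    ultimately show False
      using nz leading_coeff_0_iff[of "p' - p"] by simp
  qed
qed (use assms in blast)

lemma minpoly_in_range:
  assumes "x \<in> range emb"
  shows "map_poly emb (minpoly emb x) = [:- x, 1:]"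
proof -
  obtain y where y: "x = emb y"
    using assms by auto
  have map: "map_poly emb [:- y, 1:] = [:- x, 1:]"
    by (simp add: y map_poly_pCons emb_minus)
  have "minpoly emb x = [:- y, 1:]"
  proof (rule minpoly_eqI)
    fix r :: "'a poly" assume r: "r \<noteq> 0" "ev r x = 0"
    have "degree r \<noteq> 0"
    proof
      assume "degree r = 0"
      then obtain a where "r = [:a:]"
        by (rule degree_eq_zeroE)
      with r show False by (simp add: map_poly_pCons)
    qed
    then show "degree [:- y, 1:] \<le> degree r" by simp
  qed (simp_all add: map)
  then show ?thesis
    using map by simp
qed

text \<open>Trace and norm of \<open>x\<close> are fixed by Frobenius, so the quadratic has
  coefficients in the small field. A nonzero polynomial of degree at most one with root
  \<open>x\<close> would place \<open>x\<close> there too.\<close>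

lemma minpoly_not_in_range:
  assumes "x \<notin> range emb"
  shows "map_poly emb (minpoly emb x) = [:- x, 1:] * [:- (x ^ q), 1:]"
proof -
  obtain t where t: "x + x ^ q = emb t"
    using tr_in_range[of x] by (auto simp: tr_def)
  have "x * x ^ q \<in> range emb"
    by (simp add: range_emb power_mult_distrib power_q_square mult.commute flip: power_mult)
  then obtain d where d: "x * x ^ q = emb d"
    by auto
  have map: "map_poly emb [:d, - t, 1:] = [:- x, 1:] * [:- (x ^ q), 1:]"
  proof -
    have "map_poly emb [:d, - t, 1:] = [:emb d, - emb t, 1:]"
      by (simp add: map_poly_pCons emb_minus)
    also have "\<dots> = [:- x, 1:] * [:- (x ^ q), 1:]"
      unfolding d[symmetric] t[symmetric] by simp
    finally show ?thesis .
  qed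
  have "minpoly emb x = [:d, - t, 1:]"
  proof (rule minpoly_eqI)
    show "ev [:d, - t, 1:] x = 0"
      unfolding map by simp
    fix r :: "'a poly" assume r: "r \<noteq> 0" "ev r x = 0"
    show "degree [:d, - t, 1:] \<le> degree r"
    proof (rule ccontr)
      assume "\<not> degree [:d, - t, 1:] \<le> degree r"
      then have "degree r \<le> 1" by simp
      obtain a s where as: "r = pCons a s"
        by (cases r)
      with \<open>degree r \<le> 1\<close> have "degree s = 0"
        by (cases "s = 0") auto
      then obtain b where "s = [:b:]"
        by (rule degree_eq_zeroE)
      with as have rab: "r = [:a, b:]" by simp
      then have eq: "emb a + x * emb b = 0"
        using r(2) by (simp add: map_poly_pCons)
      have "b \<noteq> 0"
        using eq r(1) rab by auto
      then have "x = emb (- a * inverse b)"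
      proof -
        have "emb b * emb (inverse b) = 1"
          using \<open>b \<noteq> 0\<close> by (simp flip: emb_mult)
        then show ?thesis
          using eq unfolding emb_mult emb_minus by algebra
      qed
      then show False
        using assms by auto
    qed
  qed simp_all
  then show ?thesis
    using map by simp
qed

text \<open>Invariance under Frobenius says that (q-1)(q+1) divides (q-1)k, and the factor q-1
  cancels.\<close>

lemma gamma_powi_in_range_iff: "\<gamma> powi k \<in> range emb \<longleftrightarrow> (int q + 1) dvd k"
proof -
  have "\<gamma> powi k \<in> range emb \<longleftrightarrow> \<gamma> powi (k * int q) = \<gamma> powi k"
    by (simp add: range_emb power_int_mult)
  also have "\<dots> \<longleftrightarrow> \<gamma> powi (k * int q - k) = 1"
    using gamma_nonzero by (simp add: power_int_diff)
  also have "\<dots> \<longleftrightarrow> (int q - 1) * (int q + 1) dvd (int q - 1) * k"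
    unfolding gamma_powi_eq_1_iff int_n by (simp add: algebra_simps)
  also have "\<dots> \<longleftrightarrow> (int q + 1) dvd k"
    using q_ge_2 by simp
  finally show ?thesis .
qed

lemma nonzero_eq_powi_gamma:
  assumes "x \<noteq> 0"
  obtains k :: int where "x = \<gamma> powi (- k)"
proof -
  obtain i where "x = \<gamma> ^ i"
    using nonzero_eq_power_gamma[OF assms] by blast
  then have "x = \<gamma> powi (- (- int i))"
    by simp
  then show ?thesis ..
qed

lemma power_q_inject: "x ^ q = y ^ q \<longleftrightarrow> x = y" for x y :: 'b
  by (metis power_mult power_q_square)

text \<open>The map \<open>x\<close> to \<open>B * x powi m\<close> permutes the nonzero elements,
  so the trace fibre over \<open>- A\<close> is counted. For \<open>A = 0\<close> this fibre
  contains 0, which is left out.\<close>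

lemma card_tr_affine_zeros:
  assumes "coprime m (int n)" "A \<in> range emb" "B \<noteq> 0"
  shows "card {x. x \<noteq> 0 \<and> A + tr (B * x powi m) = 0} = (if A = 0 then q - 1 else q)"
proof -
  have "bij_betw ((*) B) {x. x \<noteq> 0} {x. x \<noteq> 0}"
    by (rule bij_betwI[of _ _ _ "(*) (inverse B)"]) (use assms(3) in auto)
  from bij_betw_trans[OF bij_betw_power_int[OF assms(1)] this]
  have bij: "bij_betw (\<lambda>x. B * x powi m) {x. x \<noteq> 0} {x. x \<noteq> 0}"
    by (simp add: comp_def)
  have "bij_betw (\<lambda>x. B * x powi m) {x. x \<noteq> 0 \<and> A + tr (B * x powi m) = 0} {y. y \<noteq> 0 \<and> A + tr y = 0}"
  proof (rule bij_betw_subset[OF bij])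
    show "(\<lambda>x. B * x powi m) ` {x. x \<noteq> 0 \<and> A + tr (B * x powi m) = 0} = {y. y \<noteq> 0 \<and> A + tr y = 0}"
    proof (intro equalityI subsetI)
      fix y assume y: "y \<in> {y. y \<noteq> 0 \<and> A + tr y = 0}"
      then have "y \<in> (\<lambda>x. B * x powi m) ` {x. x \<noteq> 0}"
        using bij by (simp add: bij_betw_def)
      with y show "y \<in> (\<lambda>x. B * x powi m) ` {x. x \<noteq> 0 \<and> A + tr (B * x powi m) = 0}"
        by auto
    qed (use assms(3) in auto)
  qed auto
  then have "card {x. x \<noteq> 0 \<and> A + tr (B * x powi m) = 0} = card {y. y \<noteq> 0 \<and> A + tr y = 0}"
    by (rule bij_betw_same_card)
  also have "\<dots> = (if A = 0 then q - 1 else q)"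
  proof -
    have tr0: "tr 0 = 0"
      using q_ge_2 by (simp add: tr_def)
    have "- A \<in> range emb"
      using assms(2) by (auto simp flip: emb_minus)
    then have fib: "card {y. tr y = - A} = q"
      by (rule card_tr_fibre)
    show ?thesis
    proof (cases "A = 0")
      case True
      then have "{y. y \<noteq> 0 \<and> A + tr y = 0} = {y. tr y = - A} - {0}"
        by auto
      then show ?thesis
        using True fib tr0 by (simp add: card_Diff_singleton)
    next
      case False
      then have "{y. y \<noteq> 0 \<and> A + tr y = 0} = {y. tr y = - A}"
        using tr0 by (auto simp: eq_neg_iff_add_eq_0 add.commute)
      then show ?thesis
        using False fib by simp
    qed
  qed
  finally show ?thesis .
qed

lemma card_zeros_plus_nonzeros:
  "card {x::'b. x \<noteq> 0 \<and> P x} + card {x. x \<noteq> 0 \<and> \<not> P x} = n"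
proof -
  have "card ({x::'b. x \<noteq> 0 \<and> P x} \<union> {x. x \<noteq> 0 \<and> \<not> P x})
      = card {x::'b. x \<noteq> 0 \<and> P x} + card {x. x \<noteq> 0 \<and> \<not> P x}"
    by (rule card_Un_disjoint) auto
  moreover have "{x::'b. x \<noteq> 0 \<and> P x} \<union> {x. x \<noteq> 0 \<and> \<not> P x} = {x. x \<noteq> 0}"
    by auto
  ultimately show ?thesis
    by (simp only: card_nonzero)
qed

section \<open>Codes with one rational root and one conjugate pair\<close>

context
  fixes C :: "'a poly set" and h :: "'a poly" and e1 e2 :: int
  assumes pc: "parity_check_poly n C h"
    and h_eq: "h = minpoly emb (\<gamma> powi (- ((int q + 1) * e1))) * minpoly emb (\<gamma> powi (- e2))"
    and e2_ndvd: "\<not> (int q + 1) dvd e2"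
begin

private abbreviation "\<beta>1 \<equiv> \<gamma> powi (- ((int q + 1) * e1))"
private abbreviation "\<beta>2 \<equiv> \<gamma> powi (- e2)"

text \<open>The coordinates \<open>(A, B)\<close> of the codeword with entries
  \<open>A \<gamma>\<^bsup>(q+1) e\<^sub>1 i\<^esup> + Tr (B \<gamma>\<^bsup>e\<^sub>2 i\<^esup>)\<close>.\<close>
definition code_coords :: "'a poly \<Rightarrow> 'b \<times> 'b" where
  "code_coords c = (- ev c \<beta>1, - ev c \<beta>2)"

lemma parity_check_roots:
  "{x. ev h x = 0} = {\<beta>1, \<beta>2, \<beta>2 ^ q}" "\<beta>1 \<in> range emb"
  "\<beta>1 \<noteq> \<beta>2" "\<beta>1 \<noteq> \<beta>2 ^ q" "\<beta>2 \<noteq> \<beta>2 ^ q" "degree h = 3"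
proof -
  show b1: "\<beta>1 \<in> range emb"
    unfolding gamma_powi_in_range_iff by simp
  have b2: "\<beta>2 \<notin> range emb"
    unfolding gamma_powi_in_range_iff using e2_ndvd by simp
  show "\<beta>1 \<noteq> \<beta>2"
    using b1 b2 by metis
  show "\<beta>2 \<noteq> \<beta>2 ^ q"
    using b2 unfolding range_emb by auto
  \<comment> \<open>Since \<open>\<beta>1\<close> is fixed by Frobenius, equality would make
    \<open>\<beta>2 ^ q\<close> fixed as well, and by injectivity \<open>\<beta>2\<close>
    too.\<close>
  then show "\<beta>1 \<noteq> \<beta>2 ^ q"
    using b1 power_q_inject[of \<beta>2 "\<beta>2 ^ q"] unfolding range_emb by auto
  have map: "map_poly emb h = [:- \<beta>1, 1:] * ([:- \<beta>2, 1:] * [:- (\<beta>2 ^ q), 1:])"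
    unfolding h_eq map_emb_mult minpoly_in_range[OF b1] minpoly_not_in_range[OF b2] ..
  show "{x. ev h x = 0} = {\<beta>1, \<beta>2, \<beta>2 ^ q}"
  proof -
    have "poly [:- b, 1:] x = 0 \<longleftrightarrow> x = b" for b x :: 'b
      by auto
    then show ?thesis
      unfolding map poly_mult mult_eq_0_iff by blast
  qed
  have "degree (map_poly emb h) = 3"
    unfolding map by (simp add: degree_mult_eq del: mult_pCons_left mult_pCons_right)
  then show "degree h = 3"
    by (simp add: degree_map_emb)
qed

text \<open>In the inversion formula over the three roots, the rational factor \<open>N\<close>
  comes out of every term, and the two conjugate terms combine to a trace.\<close>

lemma codeword_coeff_trace:
  assumes c: "c \<in> C" and i: "i < n"
  defines "x \<equiv> \<gamma> ^ i"
  shows "emb (coeff c i) = x powi ((int q + 1) * e1) *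
    (fst (code_coords c) + tr (snd (code_coords c) * x powi (e2 - (int q + 1) * e1)))"
proof -
  define N where "N = x powi ((int q + 1) * e1)"
  define y where "y = x powi (e2 - (int q + 1) * e1)"
  have x: "x \<noteq> 0"
    using gamma_nonzero by (simp add: x_def)
  have "N \<in> range emb"
  proof -
    have "N = \<gamma> powi (int i * ((int q + 1) * e1))"
      unfolding N_def x_def by (simp add: power_int_mult)
    then show ?thesis
      using gamma_powi_in_range_iff by simp
  qed
  then have Nq: "N ^ q = N"
    by (simp add: range_emb)
  have Ny: "x powi e2 = N * y"
    unfolding N_def y_def using x by (simp flip: power_int_add)
  have b1: "\<beta>1 powi (- int i) = N"
    unfolding N_def x_def by (simp add: mult.commute flip: power_int_mult power_int_of_nat)
  have b2: "\<beta>2 powi (- int i) = N * y"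
    unfolding Ny[symmetric] x_def by (simp add: mult.commute flip: power_int_mult power_int_of_nat)
  have b3: "(\<beta>2 ^ q) powi (- int i) = N * y ^ q"
  proof -
    have "(\<beta>2 ^ q) powi (- int i) = (\<beta>2 powi (- int i)) ^ q"
      by (simp add: mult_ac flip: power_int_mult power_int_of_nat)
    then show ?thesis
      by (simp only: b2 power_mult_distrib Nq)
  qed
  have "emb (coeff c i) = - (\<Sum>z\<in>{\<beta>1, \<beta>2, \<beta>2 ^ q}. ev c z * z powi (- int i))"
    using codeword_coeff[OF pc c i] unfolding parity_check_roots(1) .
  also have "\<dots> = - (ev c \<beta>1 * N + (ev c \<beta>2 * (N * y) + ev c \<beta>2 ^ q * (N * y ^ q)))"
  proof -
    have "(\<Sum>z\<in>{a, b, d}. f z) = f a + (f b + f d)" if "a \<noteq> b" "a \<noteq> d" "b \<noteq> d" for a b d and f :: "'b \<Rightarrow> 'b"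
      using that by simp
    from this[OF parity_check_roots(3-5)] show ?thesis
      by (simp only: b1 b2 b3 ev_frobenius)
  qed
  also have "\<dots> = N * (- ev c \<beta>1 + tr (- ev c \<beta>2 * y))"
    by (simp add: tr_def frobenius_minus power_mult_distrib algebra_simps)
  finally show ?thesis
    by (simp add: code_coords_def N_def y_def)
qed

text \<open>The coordinates determine every entry, which gives injectivity; surjectivity follows
  because both sides have \<open>q ^ 3\<close> elements.\<close>

lemma bij_betw_code_coords: "bij_betw code_coords C (range emb \<times> UNIV)"
proof -
  have inj: "inj_on code_coords C"
  proof (rule inj_onI)
    fix c d assume c: "c \<in> C" and d: "d \<in> C" and eq: "code_coords c = code_coords d"
    have words: "c \<in> words n" "d \<in> words n"
      using pc c d by (auto simp: parity_check_poly_def)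
    show "c = d"
    proof (rule poly_eqI)
      fix i
      show "coeff c i = coeff d i"
      proof (cases "i < n")
        case True
        have "emb (coeff c i) = emb (coeff d i)"
          using codeword_coeff_trace[OF c True] codeword_coeff_trace[OF d True] eq by simp
        then show ?thesis
          using inj_emb by (simp add: inj_eq)
      next
        case False
        then show ?thesis
          using words by (auto simp: words_def coeff_eq_0)
      qed
    qed
  qed
  have sub: "code_coords ` C \<subseteq> range emb \<times> UNIV"
  proof -
    have "- ev c \<beta>1 \<in> range emb" for c
      using ev_in_range[OF parity_check_roots(2), of c] by (auto simp flip: emb_minus)
    then show ?thesis
      by (auto simp: code_coords_def)
  qed
  have "card (code_coords ` C) = q ^ 3"
    using card_code_eq_power_degree[OF pc n_pos] parity_check_roots(6) inj
    by (simp add: card_image q_eq)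
  also have "\<dots> = card (range emb \<times> (UNIV :: 'b set))"
    by (simp add: card_cartesian_product card_range_emb card_ext power2_eq_square power3_eq_cube)
  finally have "code_coords ` C = range emb \<times> UNIV"
    using sub by (intro card_subset_eq) auto
  with inj show ?thesis
    by (simp add: bij_betw_def)
qed

text \<open>The power of \<open>x\<close> in front of the bracket never vanishes, so an entry is
  zero exactly when the bracket is.\<close>

lemma hweight_plus_card_zeros:
  assumes c: "c \<in> C" and AB: "code_coords c = (A, B)"
  shows "hweight c + card {x. x \<noteq> 0 \<and> A + tr (B * x powi (e2 - (int q + 1) * e1)) = 0} = n"
proof -
  have "hweight c = card {x. x \<noteq> 0 \<and> A + tr (B * x powi (e2 - (int q + 1) * e1)) \<noteq> 0}"
  proof (rule hweight_eq_card)
    show "c \<in> words n"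
      using pc c by (auto simp: parity_check_poly_def)
    fix i assume "i < n"
    show "coeff c i \<noteq> 0 \<longleftrightarrow> A + tr (B * (\<gamma> ^ i) powi (e2 - (int q + 1) * e1)) \<noteq> 0"
      using codeword_coeff_trace[OF c \<open>i < n\<close>] AB gamma_nonzero emb_eq_0_iff[of "coeff c i"]
      by simp
  qed
  then show ?thesis
    using card_zeros_plus_nonzeros by (simp add: add.commute)
qed

end

section \<open>From the gcd conditions to the weight distribution\<close>

text \<open>The exponent is congruent to \<open>e2 - 2 * e1\<close> modulo q-1 and to
  \<open>e2\<close> modulo q+1, and \<open>n\<close> is the product of these two moduli.\<close>

lemma coprime_exponent:
  assumes "gcd (int q - 1) (2 * e1 - e2) = 1" "gcd (int q + 1) e2 = 1"
  shows "coprime (e2 - (int q + 1) * e1) (int n)"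
proof -
  let ?m = "e2 - (int q + 1) * e1"
  have "coprime ?m (int q - 1)"
  proof (rule coprimeI)
    fix d assume d: "d dvd ?m" "d dvd int q - 1"
    then have "d dvd - (?m + (int q - 1) * e1)"
      by (intro dvd_minus_iff[THEN iffD2] dvd_add dvd_mult2)
    then have "d dvd 2 * e1 - e2"
      by (simp add: algebra_simps)
    then show "is_unit d"
      using d(2) assms(1) gcd_greatest[of d "int q - 1" "2 * e1 - e2"] by simp
  qed
  moreover have "coprime ?m (int q + 1)"
  proof (rule coprimeI)
    fix d assume d: "d dvd ?m" "d dvd int q + 1"
    have "d dvd ?m + (int q + 1) * e1"
      by (rule dvd_add[OF d(1) dvd_mult2[OF d(2)]])
    then show "is_unit d"
      using d(2) assms(2) gcd_greatest[of d "int q + 1" e2] by simp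
  qed
  ultimately show ?thesis
    by (simp add: int_n)
qed

text \<open>Has the shape of the conditional in the theorem, so that it can be folded there.\<close>

definition weight_freq :: "nat \<Rightarrow> nat" where
  "weight_freq w =
    (if w = 0 then 1
     else if w = q * (q - 1) - 1 then (q - 1) * (q ^ 2 - 1)
     else if w = q * (q - 1) then q ^ 2 - 1
     else if w = q ^ 2 - 1 then q - 1
     else 0)"

text \<open>The last two inequalities keep the four weights distinct, already for
  \<open>q = 2\<close>.\<close>

lemma weights:
  "n - q = q * (q - 1) - 1" "n - (q - 1) = q * (q - 1)" "n > q" "q * (q - 1) \<ge> 2" "q * (q - 1) < n"
proof -
  obtain k where "q = Suc (Suc k)"
    using q_ge_2 by (metis add_2_eq_Suc le_Suc_ex)
  then show "n - q = q * (q - 1) - 1" "n - (q - 1) = q * (q - 1)" "n > q" "q * (q - 1) \<ge> 2" "q * (q - 1) < n"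
    by (simp_all add: n_factor)
qed

lemma weight_freq_simps:
  "weight_freq 0 = 1" "weight_freq (q * (q - 1) - 1) = (q - 1) * n"
  "weight_freq (q * (q - 1)) = n" "weight_freq n = q - 1"
  "w \<notin> {0, q * (q - 1) - 1, q * (q - 1), n} \<Longrightarrow> weight_freq w = 0"
proof -
  define v where "v = q * (q - 1)"
  have "2 \<le> v" "v < n"
    using weights(4,5) by (simp_all only: v_def)
  then show "weight_freq 0 = 1" "weight_freq (q * (q - 1) - 1) = (q - 1) * n"
    "weight_freq (q * (q - 1)) = n" "weight_freq n = q - 1"
    "w \<notin> {0, q * (q - 1) - 1, q * (q - 1), n} \<Longrightarrow> weight_freq w = 0"
    unfolding weight_freq_def n_eq[symmetric] v_def[symmetric] by auto
qed

lemma weight_freq_card: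
  assumes pc: "parity_check_poly n C
      (minpoly emb (\<gamma> powi (- ((int q + 1) * e1))) * minpoly emb (\<gamma> powi (- e2)))"
    and g1: "gcd (int q - 1) (2 * e1 - e2) = 1" and g2: "gcd (int q + 1) e2 = 1"
  shows "card {c \<in> C. hweight c = w} = weight_freq w"
proof -
  have ndvd: "\<not> (int q + 1) dvd e2"
    using g2 q_ge_2 by (auto simp: gcd_proj1_iff)
  let ?m = "e2 - (int q + 1) * e1"
  let ?T = "code_coords e1 e2"
  \<comment> \<open>The weight as a function of the coordinates: for \<open>B = 0\<close> the
    bracket is the constant \<open>A\<close>, otherwise it has \<open>q - 1\<close> or
    \<open>q\<close> zeros.\<close>
  define W where "W = (\<lambda>(A :: 'b, B :: 'b). if B = 0 then (if A = 0 then 0 else n)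
    else if A = 0 then n - (q - 1) else n - q :: nat)"
  have bij: "bij_betw ?T C (range emb \<times> UNIV)"
    by (rule bij_betw_code_coords[OF pc refl ndvd])
  have W: "hweight c = W (?T c)" if c: "c \<in> C" for c
  proof -
    obtain A B where AB: "?T c = (A, B)"
      by (cases "?T c")
    have A: "A \<in> range emb"
      using bij c AB by (metis bij_betwE mem_Sigma_iff)
    note sum = hweight_plus_card_zeros[OF pc refl ndvd c AB]
    show ?thesis
    proof (cases "B = 0")
      case True
      have "tr 0 = 0"
        using q_ge_2 by (simp add: tr_def)
      with True sum show ?thesis
        by (cases "A = 0") (auto simp: W_def AB card_nonzero)
    next
      case False
      with sum card_tr_affine_zeros[OF coprime_exponent[OF g1 g2] A False] show ?thesis
        by (auto simp: W_def AB split: if_splits)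
    qed
  qed
  have "bij_betw ?T {c \<in> C. hweight c = w} {t \<in> range emb \<times> UNIV. W t = w}"
  proof (rule bij_betw_subset[OF bij])
    have "?T ` C = range emb \<times> UNIV"
      using bij by (simp add: bij_betw_def)
    then show "?T ` {c \<in> C. hweight c = w} = {t \<in> range emb \<times> UNIV. W t = w}"
      using W by (auto simp: image_iff set_eq_iff) metis+
  qed auto
  then have "card {c \<in> C. hweight c = w} = card {t \<in> range emb \<times> UNIV. W t = w}"
    by (rule bij_betw_same_card)
  also have "\<dots> = weight_freq w"
  proof -
    have zero: "0 \<in> range emb"
      using rangeI[of emb 0] by simp
    have W_def': "W (A, B) = (if B = 0 then (if A = 0 then 0 else n)
      else if A = 0 then q * (q - 1) else q * (q - 1) - 1)" for A B
      by (simp only: W_def weights prod.case)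
    note [simp] = card_cartesian_product card_Diff_singleton card_range_emb card_ext
    consider "w = 0" | "w = q * (q - 1) - 1" | "w = q * (q - 1)" | "w = n"
      | "w \<notin> {0, q * (q - 1) - 1, q * (q - 1), n}"
      by auto
    then show ?thesis
    proof cases
      case 1
      then have "{t \<in> range emb \<times> UNIV. W t = w} = {0} \<times> {0}"
        using zero weights(4,5) by (auto simp: W_def' split: if_splits)
      then show ?thesis
        unfolding 1 weight_freq_simps by simp
    next
      case 2
      then have "{t \<in> range emb \<times> UNIV. W t = w} = (range emb - {0}) \<times> (UNIV - {0})"
        using weights(4,5) by (auto simp: W_def' split: if_splits)
      then show ?thesis
        using zero unfolding 2 weight_freq_simps by (simp add: n_eq)
    next
      case 3
      then have "{t \<in> range emb \<times> UNIV. W t = w} = {0} \<times> (UNIV - {0})"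
        using zero weights(4,5) by (auto simp: W_def' split: if_splits)
      then show ?thesis
        unfolding 3 weight_freq_simps by (simp add: n_eq)
    next
      case 4
      then have "{t \<in> range emb \<times> UNIV. W t = w} = (range emb - {0}) \<times> {0}"
        using weights(4,5) by (auto simp: W_def' split: if_splits)
      then show ?thesis
        using zero unfolding 4 weight_freq_simps by simp
    next
      case 5
      then have "{t \<in> range emb \<times> UNIV. W t = w} = {}"
        by (auto simp: W_def' split: if_splits)
      then show ?thesis
        using weight_freq_simps(5)[OF 5] by simp
    qed
  qed
  finally show ?thesis .
qed

section \<open>From the weight distribution to the exponents\<close>

context
  fixes C :: "'a poly set"
  assumes cyc: "cyclic_code n C"
    and freq: "\<And>w. card {c \<in> C. hweight c = w} = weight_freq w"
begin

lemma finite_code: "finite C"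
  using cyc finite_subset[OF _ finite_words] by (auto simp: cyclic_code_def)

lemma codeword_weight:
  assumes "c \<in> C"
  shows "hweight c \<in> {0, q * (q - 1) - 1, q * (q - 1), n}"
proof -
  have "{d \<in> C. hweight d = hweight c} \<noteq> {}"
    using assms by auto
  then have "weight_freq (hweight c) \<noteq> 0"
    unfolding freq[symmetric] using finite_code by simp
  then show ?thesis
    using weight_freq_simps(5) by (rule contrapos_np)
qed

text \<open>The four frequencies add up to q + qn, which is q^3 because n + 1 = q^2.\<close>

lemma card_code: "card C = q ^ 3"
proof -
  let ?S = "{0, q * (q - 1) - 1, q * (q - 1), n}"
  have "C = (\<Union>w\<in>?S. {c \<in> C. hweight c = w})"
    using codeword_weight by blast
  then have "card C = card (\<Union>w\<in>?S. {c \<in> C. hweight c = w})"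
    by simp
  also have "\<dots> = (\<Sum>w\<in>?S. weight_freq w)"
    unfolding freq[symmetric] using finite_code weights(4) by (intro card_UN_disjoint) auto
  also have "\<dots> = weight_freq 0 + (weight_freq (q * (q - 1) - 1) + (weight_freq (q * (q - 1)) + weight_freq n))"
  proof -
    have *: "(\<Sum>w\<in>{a, b, c, d}. f w) = f a + (f b + (f c + f d))"
      if "a < b" "b < c" "c < d" for a b c d and f :: "nat \<Rightarrow> nat"
      using that by simp
    show ?thesis
      by (rule *) (use weights(4,5) in simp_all)
  qed
  also have "\<dots> = 1 + ((q - 1) * n + (n + (q - 1)))"
    by (simp only: weight_freq_simps)
  also have "\<dots> = q ^ 3"
  proof -
    obtain k where "q = Suc (Suc k)"
      using q_ge_2 by (metis add_2_eq_Suc le_Suc_ex)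
    then show ?thesis
      by (simp add: n_factor power3_eq_cube algebra_simps)
  qed
  finally show ?thesis .
qed

lemma code_dim_eq_3: "code_dim C = 3"
proof -
  have "q ^ code_dim C = q ^ 3"
    using card_cyclic_code_eq_power_dim[OF cyc] card_code q_eq by simp
  then show ?thesis
    using q_ge_2 by (simp add: power_inject_exp)
qed

lemma obtain_light_codeword:
  obtains c where "c \<in> C" "hweight c = q * (q - 1) - 1"
proof -
  have "card {c \<in> C. hweight c = q * (q - 1) - 1} \<noteq> 0"
    unfolding freq weight_freq_simps using q_ge_2 n_pos by simp
  then have "{c \<in> C. hweight c = q * (q - 1) - 1} \<noteq> {}"
    by (metis card.empty)
  then show ?thesis
    using that by blast
qed

text \<open>Rational roots are powers of \<gamma>^(q+1), so the entry at \<open>x\<close> would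
  depend only on x^(q+1) and every weight would be a multiple of q+1. The least positive weight,
  however, is 1 modulo q+1.\<close>

lemma parity_check_roots_not_in_range:
  assumes pc: "parity_check_poly n C h"
  shows "\<not> {x. ev h x = 0} \<subseteq> range emb"
proof
  assume sub: "{x. ev h x = 0} \<subseteq> range emb"
  obtain c where c: "c \<in> C" "hweight c = q * (q - 1) - 1"
    by (rule obtain_light_codeword)
  have "\<exists>k. z = \<gamma> powi ((int q + 1) * k)" if z: "ev h z = 0" for z
  proof -
    obtain k where k: "z = \<gamma> powi (- k)"
      using nonzero_eq_powi_gamma[OF parity_check_root_nonzero[OF pc z]] .
    then have "(int q + 1) dvd - k"
      using z sub gamma_powi_in_range_iff[of "- k"] by blast
    then obtain j where "- k = (int q + 1) * j"
      by (rule dvdE)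
    with k show ?thesis
      by metis
  qed
  then obtain k where k: "\<And>z. ev h z = 0 \<Longrightarrow> z = \<gamma> powi ((int q + 1) * k z)"
    by metis
  \<comment> \<open>Here \<open>y\<close> stands for x^(q+1), and \<open>P y\<close> says that the
    entry at \<open>x\<close> is nonzero.\<close>
  define P where "P y \<longleftrightarrow> (\<Sum>z | ev h z = 0. ev c z * y powi (- k z)) \<noteq> 0" for y
  have "hweight c = card {x. x \<noteq> 0 \<and> P (x powi (int q + 1))}"
  proof (rule hweight_eq_card)
    show "c \<in> words n"
      using cyc c(1) by (auto simp: cyclic_code_def)
    fix i assume i: "i < n"
    have "z powi (- int i) = ((\<gamma> ^ i) powi (int q + 1)) powi (- k z)" if "ev h z = 0" for z
    proof -
      have "z powi (- int i) = \<gamma> powi ((int q + 1) * k z * (- int i))"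
        by (subst k[OF that]) (simp only: power_int_mult)
      also have "(int q + 1) * k z * (- int i) = int i * (int q + 1) * (- k z)"
        by (simp add: mult_ac)
      finally show ?thesis
        by (simp only: power_int_mult power_int_of_nat)
    qed
    then have "(\<Sum>z | ev h z = 0. ev c z * ((\<gamma> ^ i) powi (int q + 1)) powi (- k z)) = - emb (coeff c i)"
      unfolding codeword_coeff[OF pc c(1) i] by (auto intro!: sum.cong)
    then show "coeff c i \<noteq> 0 \<longleftrightarrow> P ((\<gamma> ^ i) powi (int q + 1))"
      by (simp add: P_def)
  qed
  moreover have "(q + 1) dvd card {x. x \<noteq> 0 \<and> P (x powi (int q + 1))}"
    by (rule dvd_card_power_int) (simp_all only: n_factor dvd_triv_right of_nat_add of_nat_1 dvd_refl)
  ultimately have "(q + 1) dvd q * (q - 1) - 1"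
    using c(2) by simp
  moreover obtain k where "q = Suc (Suc k)"
    using q_ge_2 by (metis add_2_eq_Suc le_Suc_ex)
  then have "q * (q - 1) - 1 = (q + 1) * (q - 2) + 1"
    by (simp add: algebra_simps)
  ultimately have "(q + 1) dvd 1"
    by (metis dvd_add_right_iff dvd_triv_left)
  then show False
    using q_ge_2 by simp
qed

lemma exponents_coprime:
  assumes pc: "parity_check_poly n C
      (minpoly emb (\<gamma> powi (- ((int q + 1) * e1))) * minpoly emb (\<gamma> powi (- e2)))"
    and ndvd: "\<not> (int q + 1) dvd e2"
  shows "gcd (int q - 1) (2 * e1 - e2) = 1" "gcd (int q + 1) e2 = 1"
proof -
  let ?m = "e2 - (int q + 1) * e1"
  let ?Z = "\<lambda>A B. card {x. x \<noteq> 0 \<and> A + tr (B * x powi ?m) = 0}"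
  show "gcd (int q - 1) (2 * e1 - e2) = 1"
  proof -
    obtain c where c: "c \<in> C" "hweight c = q * (q - 1) - 1"
      by (rule obtain_light_codeword)
    obtain A B where AB: "code_coords e1 e2 c = (A, B)"
      by (cases "code_coords e1 e2 c")
    have zeros: "?Z A B = q"
      using hweight_plus_card_zeros[OF pc refl ndvd c(1) AB] c(2) weights(1,3) by linarith
    define d where "d = nat (gcd (int q - 1) (2 * e1 - e2))"
    have d: "int d = gcd (int q - 1) (2 * e1 - e2)"
      by (simp add: d_def)
    have d1: "int d dvd int q - 1" "int d dvd 2 * e1 - e2"
      unfolding d by simp_all
    then have "d dvd q - 1"
      using q_ge_2 by (simp flip: int_dvd_int_iff add: of_nat_diff)
    moreover have "d dvd ?Z A B"
    proof (rule dvd_card_power_int)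
      show "d dvd n"
        using \<open>d dvd q - 1\<close> by (simp add: n_factor)
      have "int d dvd - ((2 * e1 - e2) + (int q - 1) * e1)"
        using d1 by (intro dvd_minus_iff[THEN iffD2] dvd_add dvd_mult2)
      then show "int d dvd ?m"
        by (simp add: algebra_simps)
    qed
    \<comment> \<open>The divisor \<open>d\<close> divides both the number \<open>q\<close> of zeros
      and \<open>q - 1\<close>.\<close>
    ultimately have "d dvd q - (q - 1)"
      unfolding zeros by (simp only: dvd_diff_nat)
    then show ?thesis
      using q_ge_2 d by simp
  qed
  show "gcd (int q + 1) e2 = 1"
  proof -
    define d where "d = nat (gcd (int q + 1) e2)"
    have d: "int d = gcd (int q + 1) e2"
      by (simp add: d_def)
    have d1: "int d dvd int q + 1" "int d dvd e2"
      unfolding d by simp_all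
    then have dq: "d dvd q + 1"
      by (simp flip: int_dvd_int_iff add: add.commute)
    \<comment> \<open>The kernel of the trace has at least two elements, hence a nonzero
      \<open>B\<close>. The word with coordinates \<open>(0, B)\<close> then has a zero at
      \<open>x = 1\<close>.\<close>
    have "card {y. tr y = 0} = q"
      using card_tr_fibre[of 0] rangeI[of emb 0] by simp
    then have "\<not> {y. tr y = 0} \<subseteq> {0}"
      using q_ge_2 card_mono[of "{0::'b}" "{y. tr y = 0}"] by auto
    then obtain B where B: "tr B = 0" "B \<noteq> 0"
      by auto
    have "(0, B) \<in> code_coords e1 e2 ` C"
      using bij_betw_code_coords[OF pc refl ndvd] rangeI[of emb 0] by (simp add: bij_betw_def)
    then obtain c where c: "c \<in> C" "code_coords e1 e2 c = (0, B)"
      by auto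
    have "?Z 0 B \<noteq> 0"
    proof -
      have "1 \<in> {x. x \<noteq> 0 \<and> 0 + tr (B * x powi ?m) = 0}"
        using B by simp
      then show ?thesis
        by (metis (no_types, lifting) card_0_eq empty_iff finite)
    qed
    moreover have "hweight c \<noteq> 0"
    proof
      assume "hweight c = 0"
      have "finite {i. coeff c i \<noteq> 0}"
        using MOST_coeff_eq_0[of c] by (simp add: eventually_cofinite)
      with \<open>hweight c = 0\<close> have "c = 0"
        by (simp add: hweight_def poly_eq_iff)
      then show False
        using c(2) B(2) by (simp add: code_coords_def[OF pc refl ndvd])
    qed
    \<comment> \<open>Having a zero rules out weight \<open>n\<close>, and being nonzero rules out
      weight 0.\<close>
    ultimately have zeros: "?Z 0 B = q \<or> ?Z 0 B = q - 1"
    proof -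
      assume *: "?Z 0 B \<noteq> 0" "hweight c \<noteq> 0"
      note sum = hweight_plus_card_zeros[OF pc refl ndvd c]
      from * sum codeword_weight[OF c(1)]
      consider "hweight c = q * (q - 1) - 1" | "hweight c = q * (q - 1)"
        by auto
      then show ?thesis
        using sum weights(1-4) by cases linarith+
    qed
    \<comment> \<open>For nonzero \<open>y\<close>, trace zero means
      \<open>y ^ (q - 1) = - 1\<close>. In this power the part of the exponent with
      \<open>e1\<close> becomes a multiple of \<open>n\<close>, so only \<open>e2\<close>
      remains.\<close>
    have "?Z 0 B = card {x. x \<noteq> 0 \<and> B ^ (q - 1) * x powi (e2 * (int q - 1)) = - 1}"
    proof -
      have "0 + tr (B * x powi ?m) = 0 \<longleftrightarrow> B ^ (q - 1) * x powi (e2 * (int q - 1)) = - 1"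
        if x: "x \<noteq> 0" for x
      proof -
        define y where "y = B * x powi ?m"
        have "y \<noteq> 0"
          using x B by (simp add: y_def)
        have "tr y = y * (1 + y ^ (q - 1))"
          using q_ge_2 by (simp add: tr_def algebra_simps power_eq_if)
        then have "tr y = 0 \<longleftrightarrow> y ^ (q - 1) = - 1"
          using \<open>y \<noteq> 0\<close> by (simp add: eq_neg_iff_add_eq_0 add.commute)
        also have "y ^ (q - 1) = B ^ (q - 1) * x powi (?m * (int q - 1))"
          using q_ge_2 by (simp add: y_def power_mult_distrib power_int_power' of_nat_diff)
        also have "x powi (?m * (int q - 1)) = x powi (e2 * (int q - 1))"
        proof (rule power_int_mod_n[OF x])
          have "?m * (int q - 1) - e2 * (int q - 1) = int n * - e1"
            by (simp add: int_n algebra_simps)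
          then show "int n dvd ?m * (int q - 1) - e2 * (int q - 1)"
            by simp
        qed
        finally show ?thesis
          by (simp add: y_def)
      qed
      then show ?thesis
        by (metis (no_types, lifting))
    qed
    moreover have "d * (q - 1) dvd card {x. x \<noteq> 0 \<and> B ^ (q - 1) * x powi (e2 * (int q - 1)) = - 1}"
    proof (rule dvd_card_power_int)
      show "d * (q - 1) dvd n"
        unfolding n_factor mult.commute[of "q - 1"] by (rule mult_dvd_mono[OF dq dvd_refl])
      show "int (d * (q - 1)) dvd e2 * (int q - 1)"
        using d1 q_ge_2 by (simp add: of_nat_diff mult_dvd_mono)
    qed
    ultimately have dvd: "d * (q - 1) dvd ?Z 0 B"
      by simp
    \<comment> \<open>With \<open>q\<close> zeros, \<open>d\<close> divides both \<open>q\<close>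
      and \<open>q + 1\<close>; with \<open>q - 1\<close> zeros, the factor \<open>q - 1\<close>
      cancels.\<close>
    have "d = 1"
      using zeros
    proof
      assume "?Z 0 B = q"
      with dvd have "q - 1 dvd q" "d dvd q"
        using dvd_mult_left dvd_mult_right by metis+
      then have "d dvd (q + 1) - q"
        using dq by (simp only: dvd_diff_nat)
      then show ?thesis by simp
    next
      assume "?Z 0 B = q - 1"
      with dvd show ?thesis
        using q_ge_2 by simp
    qed
    then show ?thesis
      using d by simp
  qed
qed

text \<open>The three roots are stable under Frobenius and not all rational. A non-rational root
  brings its conjugate along, and the third root is then fixed.\<close>

lemma exists_exponents:
  "\<exists>e1 e2. parity_check_poly n C
      (minpoly emb (\<gamma> powi (- ((int q + 1) * e1))) * minpoly emb (\<gamma> powi (- e2))) \<and>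
    \<not> (int q + 1) dvd e2"
proof -
  obtain h where pc: "parity_check_poly n C h"
    using cyclic_code_has_parity_check_poly[OF n_pos cyc] by blast
  have "q ^ degree h = q ^ 3"
    using card_code_eq_power_degree[OF pc n_pos] card_code q_eq by simp
  then have deg: "degree h = 3"
    using q_ge_2 by (simp add: power_inject_exp)
  define Z where "Z = {x. ev h x = 0}"
  have card_Z: "card Z = 3"
    using card_parity_check_roots[OF pc] deg by (simp add: Z_def)
  have Z_closed: "z ^ q \<in> Z" if "z \<in> Z" for z
    using that q_ge_2 by (simp add: Z_def ev_frobenius)
  obtain z2 where z2: "z2 \<in> Z" "z2 \<notin> range emb"
    using parity_check_roots_not_in_range[OF pc] by (auto simp: Z_def)
  then have ne: "z2 ^ q \<noteq> z2"
    by (simp add: range_emb)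
  have "card (Z - {z2, z2 ^ q}) = 1"
    using card_Z z2 Z_closed ne by (subst card_Diff_subset) auto
  then obtain z1 where z1: "Z - {z2, z2 ^ q} = {z1}"
    by (rule card_1_singletonE)
  then have Z_eq: "Z = {z1, z2, z2 ^ q}" and z1_ne: "z1 \<noteq> z2" "z1 \<noteq> z2 ^ q"
    using z2 Z_closed by auto
  \<comment> \<open>Frobenius is injective and swaps \<open>z2\<close> and its conjugate, so it
    cannot send \<open>z1\<close> to either of them.\<close>
  have "z1 ^ q \<noteq> z2"
    using z1_ne(2) power_q_square[of z1] by (metis power_mult)
  moreover have "z1 ^ q \<noteq> z2 ^ q"
    using z1_ne(1) power_q_inject by blast
  ultimately have "z1 ^ q = z1"
    using Z_closed[of z1] Z_eq by blast
  then have z1_range: "z1 \<in> range emb"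
    by (simp add: range_emb)
  have nz: "z1 \<noteq> 0" "z2 \<noteq> 0"
    using parity_check_root_nonzero[OF pc] Z_eq by (auto simp: Z_def)
  obtain k1 where k1: "z1 = \<gamma> powi (- k1)"
    using nonzero_eq_powi_gamma[OF nz(1)] by blast
  obtain e2 where e2: "z2 = \<gamma> powi (- e2)"
    using nonzero_eq_powi_gamma[OF nz(2)] by blast
  obtain e1 where e1: "k1 = (int q + 1) * e1"
    using z1_range gamma_powi_in_range_iff[of "- k1"] k1 by (auto elim!: dvdE)
  have "h = minpoly emb z1 * minpoly emb z2"
  proof -
    have map: "map_poly emb (minpoly emb z1 * minpoly emb z2) = [:- z1, 1:] * ([:- z2, 1:] * [:- (z2 ^ q), 1:])"
      by (simp only: map_emb_mult minpoly_in_range[OF z1_range] minpoly_not_in_range[OF z2(2)])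
    \<comment> \<open>Both sides are monic cubics that vanish on the three elements of
      \<open>Z\<close>.\<close>
    have "map_poly emb h = [:- z1, 1:] * ([:- z2, 1:] * [:- (z2 ^ q), 1:])" (is "_ = ?p")
    proof (rule poly_eqI_degree_lead_coeff[of _ 3 _ Z])
      have p: "degree ?p = 3"
        by (simp add: degree_mult_eq del: mult_pCons_left mult_pCons_right)
      then show "degree ?p \<le> 3" by simp
      have "lead_coeff ?p = 1"
        unfolding lead_coeff_mult by simp
      then have "coeff ?p 3 = 1"
        unfolding p .
      moreover have "coeff h 3 = 1"
        using pc deg by (simp add: parity_check_poly_def)
      ultimately show "coeff (map_poly emb h) 3 = coeff ?p 3"
        by (simp only: coeff_map_emb emb_1)
      show "ev h z = poly ?p z" if "z \<in> Z" for z
      proof -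
        have "poly ?p z = 0"
          using that unfolding Z_eq poly_mult by auto
        then show ?thesis
          using that by (simp add: Z_def)
      qed
    qed (simp_all add: card_Z degree_map_emb deg)
    then show ?thesis
      unfolding map[symmetric] map_emb_inject .
  qed
  moreover have "\<not> (int q + 1) dvd e2"
    using z2(2) gamma_powi_in_range_iff[of "- e2"] e2 by simp
  ultimately show ?thesis
    using pc unfolding k1 e1 e2 by blast
qed

end

end

section \<open>Equivalence of the weight distribution with the gcd conditions\<close>

theorem theorem5:
  fixes emb :: "'a::{field,finite} \<Rightarrow> 'b::{field,finite}"
    and \<gamma> :: 'b and q :: nat and C :: "'a poly set"
  assumes "q = card (UNIV :: 'a set)" and "card (UNIV :: 'b set) = q ^ 2"
    and "field_emb emb"
    and "primitive_elem \<gamma>"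
    and "cyclic_code (q^2 - 1) C"
  defines "h \<equiv> (\<lambda>a::int. minpoly emb (\<gamma> powi (- a)))"
  shows "(\<forall>w. card {c \<in> C. hweight c = w} =
            (if w = 0 then 1
             else if w = q*(q-1) - 1 then (q-1)*(q^2-1)
             else if w = q*(q-1) then q^2 - 1
             else if w = q^2 - 1 then q - 1
             else 0))
     \<longleftrightarrow>
         (code_dim C = 3 \<and>
          (\<exists>e1 e2 :: int. parity_check_poly (q^2 - 1) C (h ((int q + 1) * e1) * h e2) \<and>
               gcd (int q - 1) (2*e1 - e2) = 1 \<and> gcd (int q + 1) e2 = 1))"
proof -
  interpret quadratic_extension emb \<gamma> q "q ^ 2 - 1"
    using assms(1-4) by unfold_locales auto
  show ?thesis
    unfolding weight_freq_def[symmetric] h_def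
  proof (intro iffI conjI allI)
    assume "\<forall>w. card {c \<in> C. hweight c = w} = weight_freq w"
    then have freq: "card {c \<in> C. hweight c = w} = weight_freq w" for w
      by blast
    show "code_dim C = 3"
      by (rule code_dim_eq_3[OF assms(5) freq])
    show "\<exists>e1 e2. parity_check_poly (q\<^sup>2 - 1) C
          (minpoly emb (\<gamma> powi (- ((int q + 1) * e1))) * minpoly emb (\<gamma> powi (- e2))) \<and>
        gcd (int q - 1) (2 * e1 - e2) = 1 \<and> gcd (int q + 1) e2 = 1"
      using exists_exponents[OF assms(5) freq] exponents_coprime[OF assms(5) freq] by blast
  next
    fix w
    assume "code_dim C = 3 \<and> (\<exists>e1 e2. parity_check_poly (q\<^sup>2 - 1) C
          (minpoly emb (\<gamma> powi (- ((int q + 1) * e1))) * minpoly emb (\<gamma> powi (- e2))) \<and>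
        gcd (int q - 1) (2 * e1 - e2) = 1 \<and> gcd (int q + 1) e2 = 1)"
    then show "card {c \<in> C. hweight c = w} = weight_freq w"
      by (elim conjE exE) (rule weight_freq_card)
  qed
qed

end
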